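(* Assume that $P$ and $P^{\mathrm t}P$ are irreducible. Then for all sufficiently small $\varepsilon>0$, $$\lVert J(\mu)\rVert_\varepsilon<1 .$$ Moreover, for any $\varepsilon>0$ small enough that $\lVert J(\mu)\rVert_\varepsilon<1$ and any $\eta\in(0,1-\lVert J(\mu)\rVert_\varepsilon]$, there exists $r>0$ such that for every strictly positive probability vector $\mu^0\in\mathbb R^N$ with $\lVert\mu^0-\mu\rVert_\varepsilon\le r$, the IAD iterates $\mu^k$ started from $\mu^0$ satisfy $$\lVert\mu^k-\mu\rVert_\varepsilon\le(\lVert J(\mu)\rVert_\varepsilon+\eta)^k\,\lVert\mu^0-\mu\rVert_\varepsilon\qquad\text{for all }k\in\mathbb N .$$
   Context: Setting. $P\in\mathbb R^{N\times N}$ is column stochastic (nonnegative entries, each column sums to one) and irreducible; $\mu\in\mathbb R^N$ is its unique steady-state probability vector, $P\mu=\mu$ (all entries of $\mu$ are positive). $\Omega=\{1,\dots,N\}$ is partitioned into disjoint nonempty sets $S_1,\dots,S_n$, called coarse states (elements of $\Omega$ are fine states). $\mathbf 1$ is the all-ones vector and $I$ the identity, of dimension determined by context. For a vector, $\nu>0$ means all entries are positive. $M^{\mathrm t}$ is the transpose. Aggregation: $A:\mathbb R^N\to\mathbb R^n$, $(A\nu)_i=\sum_{x\in S_i}\nu_x$. Disaggregation: for a probability vector $\nu\in\mathbb R^N$ with $A\nu>0$, $D(\nu):\mathbb R^n\to\mathbb R^N$, $(D(\nu)z)_j=z_i\,\nu_j/(A\nu)_i$ where $i$ is the index with $j\in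 S_i$. Coarse matrix: $C(\nu)=APD(\nu)\in\mathbb R^{n\times n}$. For an irreducible column stochastic $M$, $z(M)$ is the unique probability vector with $Mz(M)=z(M)$. IAD iteration (iterative aggregation/disaggregation): given a probability vector $\mu^0>0$, define $\mu^{k+\frac12}=D(\mu^k)z(C(\mu^k))$ and $\mu^{k+1}=P\mu^{k+\frac12}$ for $k\ge 0$ (for $\mu^0>0$ all these objects are well defined). $\hat P=P-\mu\mathbf 1^{\mathrm t}$. For a probability vector $\nu>0$: $S(\nu)=D(\nu)[A(I-P+\mu\mathbf 1^{\mathrm t})D(\nu)]^{-1}A(I-P+\mu\mathbf 1^{\mathrm t})$ (the inverted matrix is indeed invertible), $J(\nu)=\hat P(I-S(\nu))$, and $\Pi(\nu)=D(\nu)A$. Norms: for $w\in\mathbb R^N$, $w>0$, $\langle x,y\rangle_w=\sum_i x_iy_iw_i$; $1/\mu$ denotes the entrywise reciprocal. For $\varepsilon>0$, $\langle x,y\rangle_\varepsilon=\langle x,(I-\Pi(\mu))y\rangle_{1/\mu}+\varepsilon\langle x,\Pi(\mu)y\rangle_{1/\mu}$, which is an inner product on $\mathbb R^N$, and $\lVert x\rVert_\varepsilon=\langle x,x\rangle_\varepsilon^{1/2}$; for matrices $\lVert\cdot\rVert_\varepsilon$ is the induced operator norm. *)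

theory Defs
  imports "HOL-Analysis.Analysis"
begin

text \<open>
  Fine states are the elements of a finite type \<open>'n\<close>, coarse states the indices of a finite
  type \<open>'m\<close>; \<open>S :: 'm \<Rightarrow> 'n set\<close> is the partition. As usual in HOL-Analysis,
  \<open>M :: real^'c^'r\<close> has rows indexed by \<open>'r\<close>, so \<open>M $ i $ j\<close> is the entry in row \<open>i\<close>, column \<open>j\<close>.
\<close>

definition coarse_partition :: "('m::finite \<Rightarrow> 'n::finite set) \<Rightarrow> bool" where
  "coarse_partition S \<longleftrightarrow>
     disjoint_family S \<and> (\<forall>i. S i \<noteq> {}) \<and> (\<Union>i. S i) = UNIV"

definition prob_vec :: "real^'n::finite \<Rightarrow> bool" where
  "prob_vec v \<longleftrightarrow> (\<forall>i. 0 \<le> v $ i) \<and> (\<Sum>i\<in>UNIV. v $ i) = 1"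

definition pos_vec :: "real^'n::finite \<Rightarrow> bool" where
  "pos_vec v \<longleftrightarrow> (\<forall>i. 0 < v $ i)"

definition column_stochastic :: "real^'n::finite^'n \<Rightarrow> bool" where
  "column_stochastic M \<longleftrightarrow>
     (\<forall>i j. 0 \<le> M $ i $ j) \<and> (\<forall>j. (\<Sum>i\<in>UNIV. M $ i $ j) = 1)"

definition mat_pow :: "real^'n::finite^'n \<Rightarrow> nat \<Rightarrow> real^'n^'n" where
  "mat_pow M k = (((**) M) ^^ k) (mat 1)"

text \<open>Irreducibility is only meaningful here for matrices with nonnegative entries.\<close>

definition irreducible_mat :: "real^'n::finite^'n \<Rightarrow> bool" where
  "irreducible_mat M \<longleftrightarrow> (\<forall>i j. \<exists>k\<ge>1. 0 < mat_pow M k $ i $ j)"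

definition steady_state :: "real^'n::finite^'n \<Rightarrow> real^'n" where
  "steady_state M = (THE v. prob_vec v \<and> M *v v = v)"

definition aggr :: "('m::finite \<Rightarrow> 'n::finite set) \<Rightarrow> real^'n^'m" where
  "aggr S = matrix (\<lambda>v. \<chi> i. \<Sum>x\<in>S i. v $ x)"

definition coarse_of :: "('m::finite \<Rightarrow> 'n::finite set) \<Rightarrow> 'n \<Rightarrow> 'm" where
  "coarse_of S j = (THE i. j \<in> S i)"

definition disaggr :: "('m::finite \<Rightarrow> 'n::finite set) \<Rightarrow> real^'n \<Rightarrow> real^'m^'n" where
  "disaggr S v =
     matrix (\<lambda>z. \<chi> j. z $ coarse_of S j * v $ j / (aggr S *v v) $ coarse_of S j)"

definition coarse_matrix ::
  "('m::finite \<Rightarrow> 'n::finite set) \<Rightarrow> real^'n^'n \<Rightarrow> real^'n \<Rightarrow> real^'m^'m" where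
  "coarse_matrix S P v = aggr S ** P ** disaggr S v"

definition iad_half ::
  "('m::finite \<Rightarrow> 'n::finite set) \<Rightarrow> real^'n^'n \<Rightarrow> real^'n \<Rightarrow> real^'n" where
  "iad_half S P v = disaggr S v *v steady_state (coarse_matrix S P v)"

primrec iad ::
  "('m::finite \<Rightarrow> 'n::finite set) \<Rightarrow> real^'n^'n \<Rightarrow> real^'n \<Rightarrow> nat \<Rightarrow> real^'n" where
  "iad S P v0 0 = v0"
| "iad S P v0 (Suc k) = P *v iad_half S P (iad S P v0 k)"

text \<open>\<open>outer_one \<mu>\<close> is the rank-one matrix \<open>\<mu> 1\<^sup>t\<close>.\<close>

definition outer_one :: "real^'n::finite \<Rightarrow> real^'n^'n" where
  "outer_one \<mu> = (columnvector \<mu> :: real^1^'n) ** rowvector 1"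

definition P_hat :: "real^'n::finite^'n \<Rightarrow> real^'n \<Rightarrow> real^'n^'n" where
  "P_hat P \<mu> = P - outer_one \<mu>"

definition S_mat ::
  "('m::finite \<Rightarrow> 'n::finite set) \<Rightarrow> real^'n^'n \<Rightarrow> real^'n \<Rightarrow> real^'n \<Rightarrow> real^'n^'n" where
  "S_mat S P \<mu> v =
     disaggr S v
     ** matrix_inv (aggr S ** (mat 1 - P + outer_one \<mu>) ** disaggr S v)
     ** aggr S ** (mat 1 - P + outer_one \<mu>)"

definition J_mat ::
  "('m::finite \<Rightarrow> 'n::finite set) \<Rightarrow> real^'n^'n \<Rightarrow> real^'n \<Rightarrow> real^'n \<Rightarrow> real^'n^'n" where
  "J_mat S P \<mu> v = P_hat P \<mu> ** (mat 1 - S_mat S P \<mu> v)"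

definition Pi_mat ::
  "('m::finite \<Rightarrow> 'n::finite set) \<Rightarrow> real^'n \<Rightarrow> real^'n^'n" where
  "Pi_mat S v = disaggr S v ** aggr S"

definition weighted_inner :: "real^'n::finite \<Rightarrow> real^'n \<Rightarrow> real^'n \<Rightarrow> real" where
  "weighted_inner w x y = (\<Sum>i\<in>UNIV. x $ i * y $ i * w $ i)"

definition eps_inner ::
  "('m::finite \<Rightarrow> 'n::finite set) \<Rightarrow> real^'n \<Rightarrow> real \<Rightarrow> real^'n \<Rightarrow> real^'n \<Rightarrow> real" where
  "eps_inner S \<mu> \<epsilon> x y =
     weighted_inner (\<chi> i. 1 / \<mu> $ i) x ((mat 1 - Pi_mat S \<mu>) *v y)
     + \<epsilon> * weighted_inner (\<chi> i. 1 / \<mu> $ i) x (Pi_mat S \<mu> *v y)"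

definition eps_norm ::
  "('m::finite \<Rightarrow> 'n::finite set) \<Rightarrow> real^'n \<Rightarrow> real \<Rightarrow> real^'n \<Rightarrow> real" where
  "eps_norm S \<mu> \<epsilon> x = sqrt (eps_inner S \<mu> \<epsilon> x x)"

text \<open>The induced operator norm, in the same form as \<^const>\<open>onorm\<close>.\<close>

definition eps_onorm ::
  "('m::finite \<Rightarrow> 'n::finite set) \<Rightarrow> real^'n \<Rightarrow> real \<Rightarrow> real^'n^'n \<Rightarrow> real" where
  "eps_onorm S \<mu> \<epsilon> M = (SUP x. eps_norm S \<mu> \<epsilon> (M *v x) / eps_norm S \<mu> \<epsilon> x)"

end

theory Submission
  imports Defs
begin

text \<open>
Write \<open>A\<close>, \<open>D(\<nu>)\<close>, \<open>S(\<nu>)\<close>, \<open>J(\<nu>)\<close>, \<open>\<Pi> = D(\<mu>) A\<close> and \<open>P' = P - \<mu> 1\<^sup>t\<close> as in the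
definitions of the iteration, and let \<open>N x = \<Sum>i. x\<^sub>i\<^sup>2 / \<mu>\<^sub>i\<close>. Everything rests on one analytic
fact: \<open>N (P' x) < N x\<close> for \<open>x \<noteq> 0\<close>. For \<open>x\<close> with entry sum \<open>0\<close> the loss \<open>N x - N (P x)\<close> is a
sum of variances, namely \<open>1/2 \<Sum>i j k. P\<^sub>i\<^sub>j P\<^sub>i\<^sub>k \<mu>\<^sub>j \<mu>\<^sub>k (x\<^sub>j/\<mu>\<^sub>j - x\<^sub>k/\<mu>\<^sub>k)\<^sup>2 / \<mu>\<^sub>i\<close>; if it
vanishes, \<open>x/\<mu>\<close> agrees on any two states joined by an edge of \<open>P\<^sup>t P\<close>, so irreducibility of
\<open>P\<^sup>t P\<close> makes \<open>x\<close> a multiple of \<open>\<mu>\<close>, hence zero. A general \<open>x\<close> is first projected orthogonally off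
\<open>\<mu>\<close>, which is what subtracting \<open>\<mu> 1\<^sup>t\<close> does. By compactness the factor is some \<open>\<rho> < 1\<close>
(\<open>P_hat_uniform_contraction\<close>).

The bound on the norm of \<open>J(\<mu>)\<close> follows by Pythagoras. \<open>\<Pi>\<close> is the orthogonal projection onto the
range of \<open>D(\<mu>)\<close> for the inner product of \<open>N\<close>. Put \<open>u = x - \<Pi> x\<close> and \<open>v = u - S(\<mu>) u\<close>. Then
\<open>J(\<mu>) x = P' v\<close>, the coarse part of \<open>P' v\<close> is that of \<open>v\<close>, and the fine part of \<open>v\<close> is \<open>u\<close>.
Removing the same coarse part from both sides of \<open>N (P' v) \<le> \<rho> N v\<close> gives
\<open>N ((I - \<Pi>) J(\<mu>) x) \<le> \<rho> N u\<close>. The coarse part of \<open>J(\<mu>) x\<close> is bounded by some multiple of \<open>N u\<close>,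
and the weight \<open>\<epsilon>\<close> makes it harmless (\<open>J_mat_mu_norm_bound\<close>).

For the iteration, the error is propagated exactly by \<open>J(\<nu>)\<close>: one step sends \<open>\<nu>\<close> to
\<open>\<mu> + J(\<nu>)(\<nu> - \<mu>)\<close> (\<open>iad_step_error\<close>). Since \<open>J\<close> is continuous at \<open>\<mu>\<close>, the factor is at most
\<open>\<parallel>J(\<mu>)\<parallel> + \<eta> \<le> 1\<close> on a small ball, which the iterates therefore never leave. The coarse
stationary vector is the solution of \<open>A (I - P') D(\<nu>) z = A \<mu>\<close>. At \<open>\<nu> = \<mu>\<close> the matrix is
invertible, again by the contraction, and the solution is \<open>A \<mu>\<close>; near \<open>\<mu>\<close> both invertibility and
positivity of the solution persist by continuity.
\<close>

section \<open>Irreducible and stochastic matrices\<close>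

text \<open>
Twice the variance of \<open>y\<close> under the weights \<open>a\<close>, up to normalisation; it turns the defect in the
Cauchy--Schwarz inequality into a sum of squares whose vanishing can be read off termwise.
\<close>

lemma lagrange_identity_weighted:
  fixes a y :: "'a \<Rightarrow> real"
  shows "(\<Sum>j\<in>A. \<Sum>k\<in>A. a j * a k * (y j - y k)\<^sup>2)
         = 2 * ((\<Sum>j\<in>A. a j) * (\<Sum>j\<in>A. a j * (y j)\<^sup>2) - (\<Sum>j\<in>A. a j * y j)\<^sup>2)"
proof -
  have "(\<Sum>j\<in>A. \<Sum>k\<in>A. a j * a k * (y j - y k)\<^sup>2)
        = (\<Sum>j\<in>A. \<Sum>k\<in>A. a j * (y j)\<^sup>2 * a k + a j * (a k * (y k)\<^sup>2)
             - 2 * (a j * y j * (a k * y k)))"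
    by (intro sum.cong refl) (simp add: power2_eq_square algebra_simps)
  also have "\<dots> = (\<Sum>j\<in>A. a j * (y j)\<^sup>2) * (\<Sum>k\<in>A. a k) + (\<Sum>j\<in>A. a j) * (\<Sum>k\<in>A. a k * (y k)\<^sup>2)
             - 2 * ((\<Sum>j\<in>A. a j * y j) * (\<Sum>k\<in>A. a k * y k))"
    by (simp add: sum.distrib sum_subtractf sum_product flip: sum_distrib_left)
  finally show ?thesis by (simp add: power2_eq_square algebra_simps)
qed

lemma mat_pow_Suc: "mat_pow M (Suc k) = M ** mat_pow M k"
  by (simp add: mat_pow_def)

lemma mat_pow_0: "mat_pow M 0 = mat 1"
  by (simp add: mat_pow_def)

lemma mat_pow_nonneg:
  assumes "\<And>i j. 0 \<le> M $ i $ j"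
  shows "0 \<le> mat_pow M k $ i $ j"
proof (induction k arbitrary: i)
  case 0
  then show ?case by (simp add: mat_pow_0 mat_def)
next
  case (Suc k)
  then show ?case using assms by (simp add: mat_pow_Suc matrix_matrix_mult_def sum_nonneg)
qed

lemma mat_pow_fixed:
  assumes "M *v v = v"
  shows "mat_pow M k *v v = v"
proof (induction k)
  case (Suc k)
  then show ?case using assms by (simp add: mat_pow_Suc flip: matrix_vector_mul_assoc)
qed (simp add: mat_pow_0)

text \<open>
Mass at a single state is carried to every other state by some power of \<open>M\<close>, which also fixes \<open>v\<close>.
\<close>

lemma irreducible_steady_state_pos:
  assumes nonneg: "\<And>i j. 0 \<le> M $ i $ j" and irr: "irreducible_mat M"
    and prob: "prob_vec v" and fixed: "M *v v = v"
  shows "pos_vec v"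
proof -
  have v0: "0 \<le> v $ i" for i using prob by (simp add: prob_vec_def)
  have "\<exists>i. v $ i \<noteq> 0"
  proof (rule ccontr)
    assume "\<not> ?thesis"
    then have "(\<Sum>i\<in>UNIV. v $ i) = 0" by simp
    then show False using prob by (simp add: prob_vec_def)
  qed
  then obtain i where i: "v $ i > 0" using v0 by (metis less_le)
  have "0 < v $ j" for j
  proof -
    obtain k where k: "0 < mat_pow M k $ j $ i"
      using irr by (auto simp: irreducible_mat_def)
    have "v $ j = (mat_pow M k *v v) $ j" by (simp add: mat_pow_fixed[OF fixed])
    also have "\<dots> = (\<Sum>l\<in>UNIV. mat_pow M k $ j $ l * v $ l)"
      by (simp add: matrix_vector_mult_def)
    also have "\<dots> \<ge> mat_pow M k $ j $ i * v $ i"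
      using mat_pow_nonneg[OF nonneg] v0 by (intro member_le_sum) auto
    finally show ?thesis using k i by (smt (verit) mult_pos_pos)
  qed
  then show ?thesis by (simp add: pos_vec_def)
qed

text \<open>
A nonzero entry of a power of \<open>M\<close> is a path of nonzero entries of \<open>M\<close>, and \<open>y\<close> does not change along
such a path.
\<close>

lemma irreducible_imp_constant:
  assumes irr: "irreducible_mat M"
    and edge: "\<And>j k. M $ j $ k \<noteq> 0 \<Longrightarrow> y j = y k"
  shows "y j = y k"
proof -
  have path: "mat_pow M n $ j $ k \<noteq> 0 \<Longrightarrow> y j = y k" for n j
  proof (induction n arbitrary: j)
    case 0
    then show ?case by (simp add: mat_pow_0 mat_def split: if_splits)
  next
    case (Suc n)
    then have "(\<Sum>h\<in>UNIV. M $ j $ h * mat_pow M n $ h $ k) \<noteq> 0"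
      by (simp add: mat_pow_Suc matrix_matrix_mult_def)
    then obtain h where "M $ j $ h * mat_pow M n $ h $ k \<noteq> 0"
      by (meson sum.neutral)
    then show ?case using Suc.IH edge by (metis mult_eq_0_iff)
  qed
  obtain n where "0 < mat_pow M n $ j $ k" using irr by (auto simp: irreducible_mat_def)
  then show ?thesis using path by (metis less_irrefl)
qed

section \<open>Convergence and bounds for matrices\<close>

lemma tendsto_matrix_mult:
  fixes A :: "'a \<Rightarrow> real^'n^'m" and B :: "'a \<Rightarrow> real^'p^'n"
  assumes "(A \<longlongrightarrow> a) F" "(B \<longlongrightarrow> b) F"
  shows "((\<lambda>x. A x ** B x) \<longlongrightarrow> a ** b) F"
  unfolding matrix_matrix_mult_def by (intro tendsto_intros assms)

lemma tendsto_matrix_vector_mult: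
  fixes A :: "'a \<Rightarrow> real^'n^'m"
  assumes "(A \<longlongrightarrow> a) F" "(B \<longlongrightarrow> b) F"
  shows "((\<lambda>x. A x *v B x) \<longlongrightarrow> a *v b) F"
  unfolding matrix_vector_mult_def by (intro tendsto_intros assms)

lemma tendsto_det:
  fixes A :: "'a \<Rightarrow> real^'n^'n"
  assumes "(A \<longlongrightarrow> a) F"
  shows "((\<lambda>x. det (A x)) \<longlongrightarrow> det a) F"
  unfolding det_def by (intro tendsto_intros assms)

lemma matrix_inv_cancel:
  fixes A :: "real^'n^'n"
  assumes "invertible A"
  shows "A ** matrix_inv A = mat 1" "matrix_inv A ** A = mat 1"
  using someI_ex[OF assms[unfolded invertible_def]] by (auto simp: matrix_inv_def)

text \<open>
Cramer's rule makes the entries of the inverse rational functions of the entries of the matrix; this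
is what the continuity of inversion below relies on.
\<close>

lemma matrix_inv_cramer:
  fixes A :: "real^'n^'n"
  assumes "det A \<noteq> 0"
  shows "matrix_inv A $ k $ l
         = det (\<chi> i j. if j = k then axis l 1 $ i else A $ i $ j) / det A"
proof -
  have "A *v (matrix_inv A *v axis l 1) = axis l 1"
    using matrix_inv_cancel[of A] assms by (simp add: matrix_vector_mul_assoc invertible_det_nz)
  then have "(matrix_inv A *v axis l 1) $ k
      = (\<chi> k. det (\<chi> i j. if j = k then axis l 1 $ i else A $ i $ j) / det A) $ k"
    by (simp add: cramer[OF assms])
  then show ?thesis by (simp add: matrix_vector_mult_basis column_def)
qed

lemma tendsto_matrix_inv:
  fixes A :: "'a \<Rightarrow> real^'n^'n"
  assumes lim: "(A \<longlongrightarrow> a) F" and "det a \<noteq> 0"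
  shows "((\<lambda>x. matrix_inv (A x)) \<longlongrightarrow> matrix_inv a) F"
proof (intro vec_tendstoI)
  fix k l
  let ?R = "\<lambda>B. (\<chi> i j. if j = k then axis l 1 $ i else B $ i $ j) :: real^'n^'n"
  have "((\<lambda>x. ?R (A x)) \<longlongrightarrow> ?R a) F"
  proof (intro vec_tendstoI)
    fix i j
    show "((\<lambda>x. ?R (A x) $ i $ j) \<longlongrightarrow> ?R a $ i $ j) F"
      by (cases "j = k") (auto intro!: tendsto_intros lim)
  qed
  then have "((\<lambda>x. det (?R (A x)) / det (A x)) \<longlongrightarrow> det (?R a) / det a) F"
    by (intro tendsto_divide tendsto_det lim assms)
  moreover have "\<forall>\<^sub>F x in F. det (A x) \<noteq> 0"
    using tendsto_imp_eventually_ne[OF tendsto_det[OF lim]] assms by blast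
  then have "\<forall>\<^sub>F x in F. det (?R (A x)) / det (A x) = matrix_inv (A x) $ k $ l"
    by eventually_elim (simp add: matrix_inv_cramer)
  ultimately show "((\<lambda>x. matrix_inv (A x) $ k $ l) \<longlongrightarrow> matrix_inv a $ k $ l) F"
    using assms by (simp add: matrix_inv_cramer tendsto_cong)
qed

lemma eventually_pos_vec:
  fixes f :: "'a \<Rightarrow> real^'k::finite"
  assumes lim: "(f \<longlongrightarrow> a) F" and "pos_vec a"
  shows "\<forall>\<^sub>F x in F. pos_vec (f x)"
  unfolding pos_vec_def
proof (rule eventually_all_finite)
  fix i
  show "\<forall>\<^sub>F x in F. 0 < f x $ i"
    using assms by (intro order_tendstoD(1)[OF tendsto_vec_nth[OF lim]]) (simp add: pos_vec_def)
qed

lemma norm_matrix_vector_mult_le: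
  fixes A :: "real^'n^'m"
  shows "norm (A *v x) \<le> norm A * norm x"
proof -
  have "norm (A *v x) \<le> L2_set (\<lambda>i. norm (A $ i) * norm x) UNIV"
    unfolding norm_vec_def[of "A *v x"]
    by (intro L2_set_mono) (auto simp: matrix_vector_mul_component Cauchy_Schwarz_ineq2)
  also have "\<dots> = norm A * norm x"
    by (simp add: norm_vec_def[of A] L2_set_left_distrib)
  finally show ?thesis .
qed

text \<open>
Pulling the Euclidean norm back along an injective linear map gives a norm equivalent to the original
one; the constant depends on \<open>L\<close> only, which makes the bound usable for matrices that tend to zero.
\<close>

lemma norm_linear_image_le:
  fixes L :: "real^'n \<Rightarrow> 'b::euclidean_space"
  assumes "linear L" "inj L"
  obtains C where "0 < C" "\<And>B x. norm (L (B *v x)) \<le> C * norm B * norm (L x)"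
proof -
  obtain b where b: "b > 0" "\<And>x. b * norm x \<le> norm (L x)"
    using linear_inj_bounded_below_pos[OF assms] by blast
  obtain c where c: "c > 0" "\<And>x. norm (L x) \<le> c * norm x"
    using linear_bounded_pos[OF assms(1)] by blast
  have "norm (L (B *v x)) \<le> c / b * norm B * norm (L x)" for B x
  proof -
    have "norm (L (B *v x)) \<le> c * (norm B * norm x)"
      using c norm_matrix_vector_mult_le[of B x] by (meson less_imp_le mult_left_mono order_trans)
    also have "\<dots> \<le> c * (norm B * (norm (L x) / b))"
      using b c by (intro mult_left_mono) (auto simp: field_simps)
    finally show ?thesis by (simp add: field_simps)
  qed
  then show ?thesis using that[of "c / b"] b c by simp
qed

section \<open>Aggregation and disaggregation\<close>

abbreviation entry_sum :: "real^'n::finite \<Rightarrow> real" where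
  "entry_sum x \<equiv> \<Sum>i\<in>UNIV. x $ i"

locale state_partition =
  fixes S :: "'m::finite \<Rightarrow> 'n::finite set"
  assumes part: "coarse_partition S"
begin

lemma coarse_of_eq_iff: "coarse_of S j = i \<longleftrightarrow> j \<in> S i"
proof -
  have "\<exists>!i. j \<in> S i"
    using part by (auto simp: coarse_partition_def disjoint_family_on_def)
  then show ?thesis unfolding coarse_of_def by (metis theI')
qed

lemma sum_over_cells: "(\<Sum>j\<in>UNIV. f j) = (\<Sum>i\<in>UNIV. \<Sum>j\<in>S i. f j)"
proof -
  have "(\<Sum>j\<in>UNIV. f j) = (\<Sum>j\<in>(\<Union>i\<in>UNIV. S i). f j)"
    using part by (simp add: coarse_partition_def)
  also have "\<dots> = (\<Sum>i\<in>UNIV. \<Sum>j\<in>S i. f j)"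
    using part by (intro sum.UNION_disjoint) (auto simp: coarse_partition_def disjoint_family_on_def)
  finally show ?thesis .
qed

lemma aggr_nth: "(aggr S *v v) $ i = (\<Sum>x\<in>S i. v $ x)"
proof -
  have "linear (\<lambda>v::real^'n. \<chi> i. \<Sum>x\<in>S i. v $ x)"
    by (rule linearI) (auto simp: vec_eq_iff sum.distrib sum_distrib_left)
  then show ?thesis unfolding aggr_def by (simp add: matrix_works)
qed

lemma disaggr_nth:
  "(disaggr S v *v z) $ j = z $ coarse_of S j * v $ j / (aggr S *v v) $ coarse_of S j"
proof -
  have "linear (\<lambda>z::real^'m. \<chi> j. z $ coarse_of S j * v $ j / (aggr S *v v) $ coarse_of S j)"
    by (rule linearI) (auto simp: vec_eq_iff add_divide_distrib algebra_simps)
  then show ?thesis unfolding disaggr_def by (simp add: matrix_works)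
qed

lemma total_aggr: "entry_sum (aggr S *v v) = entry_sum v"
  by (simp add: aggr_nth sum_over_cells[of "\<lambda>j. v $ j"])

lemma aggr_pos:
  assumes "pos_vec v"
  shows "pos_vec (aggr S *v v)"
  using assms part by (auto simp: pos_vec_def aggr_nth coarse_partition_def intro!: sum_pos)

lemma aggr_disaggr:
  assumes "pos_vec v"
  shows "aggr S *v (disaggr S v *v z) = z"
proof -
  have "(aggr S *v (disaggr S v *v z)) $ i = z $ i" for i
  proof -
    have "(aggr S *v (disaggr S v *v z)) $ i
        = (\<Sum>x\<in>S i. z $ i * v $ x / (aggr S *v v) $ i)"
      unfolding aggr_nth[of _ i] disaggr_nth
      by (intro sum.cong refl) (auto simp: aggr_nth simp flip: coarse_of_eq_iff)
    also have "\<dots> = z $ i * (aggr S *v v) $ i / (aggr S *v v) $ i"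
      unfolding aggr_nth[of v i] by (simp add: sum_distrib_left sum_divide_distrib)
    finally show ?thesis
      using aggr_pos[OF assms] by (simp add: pos_vec_def less_imp_neq[symmetric])
  qed
  then show ?thesis by (simp add: vec_eq_iff)
qed

lemma total_disaggr:
  assumes "pos_vec v"
  shows "entry_sum (disaggr S v *v z) = entry_sum z"
  using total_aggr[of "disaggr S v *v z"] aggr_disaggr[OF assms] by simp

lemma disaggr_aggr_self:
  assumes "pos_vec v"
  shows "disaggr S v *v (aggr S *v v) = v"
  using aggr_pos[OF assms] by (simp add: vec_eq_iff disaggr_nth pos_vec_def less_imp_neq[symmetric])

text \<open>
Only the denominators could spoil continuity, and these are cell masses, positive at a positive vector.
\<close>

lemma tendsto_disaggr:
  assumes "pos_vec a"
  shows "(disaggr S \<longlongrightarrow> disaggr S a) (nhds a)"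
proof (intro vec_tendstoI)
  fix j i
  have entry: "disaggr S v $ j $ i
      = (disaggr S v *v axis i 1) $ j" for v
    by (simp add: matrix_vector_mult_basis column_def)
  have "(aggr S *v a) $ coarse_of S j \<noteq> 0"
    using aggr_pos[OF assms] by (simp add: pos_vec_def less_imp_neq[symmetric])
  then show "((\<lambda>v. disaggr S v $ j $ i) \<longlongrightarrow> disaggr S a $ j $ i) (nhds a)"
    unfolding entry disaggr_nth
    by (intro tendsto_intros tendsto_vec_nth tendsto_matrix_vector_mult filterlim_ident)
qed

end

section \<open>The weighted inner product and the contraction it provides\<close>

lemma weighted_inner_simps:
  "weighted_inner w (x + y) z = weighted_inner w x z + weighted_inner w y z"
  "weighted_inner w z (x + y) = weighted_inner w z x + weighted_inner w z y"
  "weighted_inner w (x - y) z = weighted_inner w x z - weighted_inner w y z"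
  "weighted_inner w z (x - y) = weighted_inner w z x - weighted_inner w z y"
  "weighted_inner w (c *\<^sub>R x) z = c * weighted_inner w x z"
  "weighted_inner w z (c *\<^sub>R x) = c * weighted_inner w z x"
  by (simp_all add: weighted_inner_def algebra_simps sum.distrib sum_subtractf sum_distrib_left)

lemma weighted_inner_commute: "weighted_inner w x y = weighted_inner w y x"
  by (simp add: weighted_inner_def mult.commute mult.left_commute)

locale partitioned_chain = state_partition S
  for S :: "'m::finite \<Rightarrow> 'n::finite set" +
  fixes P :: "real^'n^'n" and \<mu> :: "real^'n"
  assumes stoch: "column_stochastic P"
    and irr: "irreducible_mat P"
    and irr_PtP: "irreducible_mat (transpose P ** P)"
    and prob: "prob_vec \<mu>"
    and steady: "P *v \<mu> = \<mu>"
begin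

abbreviation mu_inner :: "real^'n \<Rightarrow> real^'n \<Rightarrow> real" where
  "mu_inner \<equiv> weighted_inner (\<chi> i. 1 / \<mu> $ i)"

abbreviation coarse_proj :: "real^'n \<Rightarrow> real^'n" where
  "coarse_proj x \<equiv> Pi_mat S \<mu> *v x"

lemma P_nonneg: "0 \<le> P $ i $ j"
  using stoch by (simp add: column_stochastic_def)

lemma mu_pos_vec: "pos_vec \<mu>"
  by (rule irreducible_steady_state_pos[OF P_nonneg irr prob steady])

lemma mu_pos: "0 < \<mu> $ i"
  using mu_pos_vec by (simp add: pos_vec_def)

lemma mu_nonzero: "\<mu> $ i \<noteq> 0"
  using mu_pos[of i] by simp

lemma total_mu: "entry_sum \<mu> = 1"
  using prob by (simp add: prob_vec_def)

lemma total_P: "entry_sum (P *v x) = entry_sum x"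
proof -
  have "entry_sum (P *v x) = (\<Sum>j\<in>UNIV. \<Sum>i\<in>UNIV. P $ i $ j * x $ j)"
    unfolding matrix_vector_mult_def by (simp, subst sum.swap, rule refl)
  also have "\<dots> = (\<Sum>j\<in>UNIV. (\<Sum>i\<in>UNIV. P $ i $ j) * x $ j)"
    by (simp add: sum_distrib_right)
  finally show ?thesis using stoch by (simp add: column_stochastic_def)
qed

lemma outer_one_mult: "outer_one \<mu> *v x = entry_sum x *\<^sub>R \<mu>"
  by (simp add: vec_eq_iff outer_one_def matrix_matrix_mult_def matrix_vector_mult_def
      columnvector_def rowvector_def sum_distrib_left mult.commute)

lemma P_hat_mult: "P_hat P \<mu> *v x = P *v x - entry_sum x *\<^sub>R \<mu>"
  by (simp add: P_hat_def matrix_vector_mult_diff_rdistrib outer_one_mult)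

lemma I_minus_P_hat: "mat 1 - P + outer_one \<mu> = mat 1 - P_hat P \<mu>"
  by (simp add: P_hat_def)

lemma mu_inner_pos:
  assumes "x \<noteq> 0"
  shows "0 < mu_inner x x"
proof -
  obtain i where "x $ i \<noteq> 0" using assms by (auto simp: vec_eq_iff)
  then have "0 < x $ i * x $ i * (1 / \<mu> $ i)"
    using mu_pos[of i] by (intro mult_pos_pos[of "x $ i * x $ i"]) (auto simp: zero_less_mult_iff)
  moreover have "0 \<le> x $ i * x $ i * (1 / \<mu> $ i)" for i
    using mu_pos[of i] by simp
  ultimately show ?thesis unfolding weighted_inner_def
    by (intro sum_pos2[of _ i]) auto
qed

lemma mu_inner_nonneg: "0 \<le> mu_inner x x"
  using mu_inner_pos[of x] by (cases "x = 0") (auto simp: weighted_inner_def)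

text \<open>
So entry sum \<open>0\<close> means orthogonal to \<open>\<mu>\<close>.
\<close>

lemma mu_inner_mu: "mu_inner x \<mu> = entry_sum x" "mu_inner \<mu> x = entry_sum x"
  using mu_nonzero by (simp_all add: weighted_inner_def)

text \<open>
Applied to row \<open>i\<close> of \<open>P\<close> with the weights \<open>P\<^sub>i\<^sub>j \<mu>\<^sub>j\<close>, whose sum is \<open>\<mu>\<^sub>i\<close> by stationarity, the
Lagrange identity expresses the loss in that row as a variance. The losses add up to the difference
of the two squared norms because the columns of \<open>P\<close> sum to one.
\<close>

lemma P_contracts_total_zero:
  assumes "entry_sum x = 0" "x \<noteq> 0"
  shows "mu_inner (P *v x) (P *v x) < mu_inner x x"
proof (rule ccontr)
  assume not_less: "\<not> ?thesis"
  define y where "y j = x $ j / \<mu> $ j" for j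
  define a where "a i j = P $ i $ j * \<mu> $ j" for i j
  define V where "V i = (\<Sum>j\<in>UNIV. \<Sum>k\<in>UNIV. a i j * a i k * (y j - y k)\<^sup>2)" for i
  have a_nonneg: "0 \<le> a i j" for i j
    using P_nonneg mu_pos[of j] by (simp add: a_def)
  have V_nonneg: "0 \<le> V i" for i
    unfolding V_def by (intro sum_nonneg mult_nonneg_nonneg a_nonneg) auto
  have V_eq: "V i / (2 * \<mu> $ i)
      = (\<Sum>j\<in>UNIV. P $ i $ j * (x $ j * x $ j / \<mu> $ j)) - (P *v x) $ i * (P *v x) $ i / \<mu> $ i" for i
  proof -
    have "(\<Sum>j\<in>UNIV. a i j) = \<mu> $ i"
      unfolding a_def using arg_cong[OF steady, of "\<lambda>v. v $ i"] by (simp add: matrix_vector_mult_def)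
    moreover have "(\<Sum>j\<in>UNIV. a i j * y j) = (P *v x) $ i"
      using mu_nonzero by (simp add: a_def y_def matrix_vector_mult_def)
    moreover have "(\<Sum>j\<in>UNIV. a i j * (y j)\<^sup>2) = (\<Sum>j\<in>UNIV. P $ i $ j * (x $ j * x $ j / \<mu> $ j))"
      by (intro sum.cong refl) (simp add: a_def y_def power2_eq_square mu_nonzero)
    ultimately have "V i = 2 * (\<mu> $ i * (\<Sum>j\<in>UNIV. P $ i $ j * (x $ j * x $ j / \<mu> $ j))
        - ((P *v x) $ i)\<^sup>2)"
      unfolding V_def lagrange_identity_weighted by simp
    then show ?thesis using mu_nonzero[of i] by (simp add: power2_eq_square diff_divide_distrib)
  qed
  have "(\<Sum>i\<in>UNIV. \<Sum>j\<in>UNIV. P $ i $ j * (x $ j * x $ j / \<mu> $ j))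
      = entry_sum (P *v (\<chi> j. x $ j * x $ j / \<mu> $ j))"
    by (simp add: matrix_vector_mult_def)
  also have "\<dots> = mu_inner x x"
    unfolding total_P by (simp add: weighted_inner_def)
  finally have sum_V: "(\<Sum>i\<in>UNIV. V i / (2 * \<mu> $ i)) = mu_inner x x - mu_inner (P *v x) (P *v x)"
    unfolding V_eq sum_subtractf by (simp add: weighted_inner_def)
  have terms: "0 \<le> V i / (2 * \<mu> $ i)" for i
    using V_nonneg[of i] mu_pos[of i] by simp
  have "(\<Sum>i\<in>UNIV. V i / (2 * \<mu> $ i)) = 0"
    using sum_V not_less sum_nonneg[of UNIV "\<lambda>i. V i / (2 * \<mu> $ i)"] terms by simp
  then have V0: "V i = 0" for i
    using terms by (simp add: sum_nonneg_eq_0_iff mu_nonzero)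
  have term_nonneg: "0 \<le> a i j * a i k * (y j - y k)\<^sup>2" for i j k
    by (intro mult_nonneg_nonneg a_nonneg) auto
  have term0: "a i j * a i k * (y j - y k)\<^sup>2 = 0" for i j k
  proof -
    have "(\<Sum>k\<in>UNIV. a i j * a i k * (y j - y k)\<^sup>2) = 0" for j
      using V0[of i] term_nonneg unfolding V_def by (simp add: sum_nonneg_eq_0_iff sum_nonneg)
    then show ?thesis
      using term_nonneg by (auto simp: sum_nonneg_eq_0_iff)
  qed
  \<comment> \<open>An edge of \<open>P\<^sup>t P\<close> between \<open>j\<close> and \<open>k\<close> is a common successor \<open>i\<close> of both, and row \<open>i\<close> compares them.\<close>
  have const: "y j = y k" for j k
  proof (rule irreducible_imp_constant[OF irr_PtP])
    fix j k
    assume "(transpose P ** P) $ j $ k \<noteq> 0"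
    then have "(\<Sum>i\<in>UNIV. P $ i $ j * P $ i $ k) \<noteq> 0"
      by (simp add: matrix_matrix_mult_def transpose_def)
    then obtain i where "P $ i $ j * P $ i $ k \<noteq> 0" by (meson sum.neutral)
    then show "y j = y k" using term0[of i j k] mu_nonzero by (simp add: a_def)
  qed
  obtain c where c: "\<And>j. y j = c" using const by blast
  have x: "x $ j = c * \<mu> $ j" for j
    using c[of j] mu_nonzero[of j] by (simp add: y_def field_simps)
  then have "entry_sum x = c" by (simp add: total_mu flip: sum_distrib_left)
  then show False using assms x by (simp add: vec_eq_iff)
qed

text \<open>
\<open>P - \<mu> 1\<^sup>t\<close> is \<open>P\<close> after the orthogonal projection onto the complement of \<open>\<mu>\<close>. If the projection
kills \<open>x\<close>, the image is zero; otherwise the previous lemma is strict.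
\<close>

lemma P_hat_contracts:
  assumes "x \<noteq> 0"
  shows "mu_inner (P_hat P \<mu> *v x) (P_hat P \<mu> *v x) < mu_inner x x"
proof -
  define w where "w = x - entry_sum x *\<^sub>R \<mu>"
  have "entry_sum w = 0"
    by (simp add: w_def sum_subtractf total_mu flip: sum_distrib_left)
  have Phat: "P_hat P \<mu> *v x = P *v w"
    by (simp add: w_def P_hat_mult matrix_vector_mult_diff_distrib matrix_vector_mult_scaleR steady)
  have pyth: "mu_inner w w = mu_inner x x - (entry_sum x)\<^sup>2"
    by (simp add: w_def weighted_inner_simps mu_inner_mu total_mu
        power2_eq_square)
  show ?thesis
  proof (cases "w = 0")
    case True
    then show ?thesis using mu_inner_pos[OF assms] by (simp add: Phat weighted_inner_def)
  next
    case False
    then have "mu_inner (P *v w) (P *v w) < mu_inner w w"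
      using P_contracts_total_zero \<open>entry_sum w = 0\<close> by blast
    then show ?thesis unfolding Phat pyth by (smt (verit) zero_le_power2)
  qed
qed

text \<open>
The Rayleigh-type quotient attains its maximum on the unit sphere, and homogeneity spreads the bound.
\<close>

lemma P_hat_uniform_contraction:
  obtains \<rho> where "0 \<le> \<rho>" "\<rho> < 1"
    "\<And>x. mu_inner (P_hat P \<mu> *v x) (P_hat P \<mu> *v x) \<le> \<rho> * mu_inner x x"
proof -
  define R where "R x = mu_inner (P_hat P \<mu> *v x) (P_hat P \<mu> *v x) / mu_inner x x" for x
  have pos: "0 < mu_inner x x" if "x \<in> sphere 0 1" for x
    using that by (intro mu_inner_pos) auto
  have "continuous_on (sphere 0 1) R"
    unfolding R_def weighted_inner_def[abs_def]
    using pos by (intro continuous_intros) (auto simp: weighted_inner_def less_imp_neq[symmetric])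
  moreover have "axis undefined 1 \<in> sphere (0::real^'n) 1" by (simp add: norm_axis_1)
  ultimately have "\<exists>x0\<in>sphere 0 1. \<forall>x\<in>sphere 0 1. R x \<le> R x0"
    by (intro continuous_attains_sup) auto
  then obtain x0 where x0: "x0 \<in> sphere 0 1" "\<And>x. x \<in> sphere 0 1 \<Longrightarrow> R x \<le> R x0"
    by blast
  have R_less: "R x0 < 1"
    using P_hat_contracts[of x0] pos[OF x0(1)] x0(1) unfolding R_def
    by (cases "x0 = 0") (auto simp: divide_less_eq_1)
  have R_nonneg: "0 \<le> R x0" unfolding R_def by (intro divide_nonneg_nonneg mu_inner_nonneg)
  have "mu_inner (P_hat P \<mu> *v x) (P_hat P \<mu> *v x) \<le> R x0 * mu_inner x x" for x
  proof (cases "x = 0")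
    case False
    have "x = norm x *\<^sub>R (x /\<^sub>R norm x)" "x /\<^sub>R norm x \<in> sphere 0 1" using False by auto
    then obtain r u where x: "x = r *\<^sub>R u" and u: "u \<in> sphere 0 1" by blast
    have "mu_inner (P_hat P \<mu> *v u) (P_hat P \<mu> *v u) \<le> R x0 * mu_inner u u"
      using x0(2)[OF u] pos[OF u] unfolding R_def[of u] by (simp add: divide_le_eq)
    then have "r * r * mu_inner (P_hat P \<mu> *v u) (P_hat P \<mu> *v u) \<le> r * r * (R x0 * mu_inner u u)"
      by (intro mult_left_mono) auto
    then show ?thesis
      by (simp add: x matrix_vector_mult_scaleR weighted_inner_simps mult_ac)
  qed (simp add: weighted_inner_def)
  then show ?thesis using that R_less R_nonneg by blast
qed

section \<open>The orthogonal projection and the family of norms\<close>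

lemma proj_mult: "coarse_proj x = disaggr S \<mu> *v (aggr S *v x)"
  by (simp add: Pi_mat_def matrix_vector_mul_assoc)

text \<open>
The inner product with a vector in the range of \<open>D(\<mu>)\<close> sees its partner only through aggregation;
this is why \<open>\<Pi>\<close> is self-adjoint, hence an orthogonal projection.
\<close>

lemma mu_inner_disaggr:
  "mu_inner x (disaggr S \<mu> *v z) = (\<Sum>i\<in>UNIV. (aggr S *v x) $ i * z $ i / (aggr S *v \<mu>) $ i)"
proof -
  have "mu_inner x (disaggr S \<mu> *v z)
      = (\<Sum>j\<in>UNIV. x $ j * (z $ coarse_of S j / (aggr S *v \<mu>) $ coarse_of S j))"
    unfolding weighted_inner_def disaggr_nth by (intro sum.cong refl) (simp add: mu_nonzero)
  also have "\<dots> = (\<Sum>i\<in>UNIV. \<Sum>j\<in>S i. x $ j * (z $ i / (aggr S *v \<mu>) $ i))"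
    unfolding sum_over_cells by (intro sum.cong refl) (auto simp flip: coarse_of_eq_iff)
  also have "\<dots> = (\<Sum>i\<in>UNIV. (aggr S *v x) $ i * z $ i / (aggr S *v \<mu>) $ i)"
    by (simp add: aggr_nth[of x] sum_distrib_right sum_divide_distrib)
  finally show ?thesis .
qed

lemma mu_inner_proj: "mu_inner x (coarse_proj y) = mu_inner (coarse_proj x) (coarse_proj y)"
  unfolding proj_mult mu_inner_disaggr by (simp add: aggr_disaggr mu_pos_vec)

lemma mu_inner_pythagoras:
  "mu_inner x x = mu_inner (x - coarse_proj x) (x - coarse_proj x) + mu_inner (coarse_proj x) (coarse_proj x)"
  using mu_inner_proj[of x x] weighted_inner_commute[of _ x "coarse_proj x"]
  by (simp add: weighted_inner_simps)

lemma eps_inner_eq: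
  "eps_inner S \<mu> \<epsilon> x x
   = mu_inner (x - coarse_proj x) (x - coarse_proj x) + \<epsilon> * mu_inner (coarse_proj x) (coarse_proj x)"
  using mu_inner_proj[of x x] weighted_inner_commute[of _ x "coarse_proj x"]
  by (simp add: eps_inner_def matrix_vector_mult_diff_rdistrib weighted_inner_simps)

text \<open>
A linear map into a Euclidean space whose pulled-back norm is the weighted norm with parameter
\<open>\<epsilon> \<ge> 0\<close>. It supplies the triangle inequality and the equivalence with the Euclidean norm.
\<close>

definition eps_embedding :: "real \<Rightarrow> real^'n \<Rightarrow> (real^'n) \<times> (real^'n)" where
  "eps_embedding \<epsilon> x =
     ((\<chi> i. (x - coarse_proj x) $ i / sqrt (\<mu> $ i)), sqrt \<epsilon> *\<^sub>R (\<chi> i. coarse_proj x $ i / sqrt (\<mu> $ i)))"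

lemma norm_scaled: "(norm (\<chi> i. x $ i / sqrt (\<mu> $ i)))\<^sup>2 = mu_inner x x"
  using mu_pos
  by (simp add: power2_norm_eq_inner inner_vec_def weighted_inner_def less_imp_le)

lemma eps_norm_eq_norm:
  assumes "0 \<le> \<epsilon>"
  shows "eps_norm S \<mu> \<epsilon> x = norm (eps_embedding \<epsilon> x)"
  using assms
  by (simp add: eps_norm_def eps_embedding_def norm_Pair eps_inner_eq norm_scaled power_mult_distrib
      del: vector_minus_component)

lemma eps_norm_squared:
  assumes "0 \<le> \<epsilon>"
  shows "(eps_norm S \<mu> \<epsilon> x)\<^sup>2
    = mu_inner (x - coarse_proj x) (x - coarse_proj x) + \<epsilon> * mu_inner (coarse_proj x) (coarse_proj x)"
  using assms by (simp add: eps_norm_def eps_inner_eq mu_inner_nonneg)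

lemma linear_eps_embedding: "linear (eps_embedding \<epsilon>)"
  by (rule linearI)
    (auto simp: eps_embedding_def vec_eq_iff algebra_simps add_divide_distrib diff_divide_distrib
      matrix_vector_right_distrib matrix_vector_mult_scaleR)

lemma inj_eps_embedding:
  assumes "0 < \<epsilon>"
  shows "inj (eps_embedding \<epsilon>)"
proof -
  have "x = 0" if "eps_embedding \<epsilon> x = 0" for x
  proof -
    have "coarse_proj x = 0" "x - coarse_proj x = 0"
      using that assms mu_nonzero by (auto simp: eps_embedding_def vec_eq_iff prod_eq_iff)
    then show ?thesis by simp
  qed
  then show ?thesis using linear_eps_embedding by (simp add: linear_injective_0)
qed

lemma eps_norm_triangle:
  assumes "0 \<le> \<epsilon>"
  shows "eps_norm S \<mu> \<epsilon> (x + y) \<le> eps_norm S \<mu> \<epsilon> x + eps_norm S \<mu> \<epsilon> y"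
  using norm_triangle_ineq[of "eps_embedding \<epsilon> x" "eps_embedding \<epsilon> y"]
  by (simp add: eps_norm_eq_norm[OF assms] linear_add[OF linear_eps_embedding])

lemma eps_norm_matrix_le:
  assumes "0 < \<epsilon>"
  obtains C where "0 < C"
    "\<And>B x. eps_norm S \<mu> \<epsilon> (B *v x) \<le> C * norm B * eps_norm S \<mu> \<epsilon> x"
  using norm_linear_image_le[OF linear_eps_embedding[of \<epsilon>] inj_eps_embedding[OF assms]]
    eps_norm_eq_norm assms by (metis less_imp_le)

lemma eps_norm_nonneg: "0 \<le> \<epsilon> \<Longrightarrow> 0 \<le> eps_norm S \<mu> \<epsilon> x"
  by (simp add: eps_norm_eq_norm)

text \<open>
The supremum defining the operator norm is over a bounded set, so it really is an upper bound. Where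
the norm of \<open>x\<close> vanishes the quotient carries no information, and \<open>eps_norm_matrix_le\<close> is used.
\<close>

lemma eps_onorm_bound:
  assumes "0 < \<epsilon>"
  shows "eps_norm S \<mu> \<epsilon> (B *v x) \<le> eps_onorm S \<mu> \<epsilon> B * eps_norm S \<mu> \<epsilon> x"
proof -
  obtain C where C: "0 < C"
    "\<And>B x. eps_norm S \<mu> \<epsilon> (B *v x) \<le> C * norm B * eps_norm S \<mu> \<epsilon> x"
    using eps_norm_matrix_le[OF assms] by blast
  have nonneg: "0 \<le> eps_norm S \<mu> \<epsilon> y" for y using eps_norm_nonneg assms by simp
  have "eps_norm S \<mu> \<epsilon> (B *v y) / eps_norm S \<mu> \<epsilon> y \<le> C * norm B" for y
    using C(1) C(2)[of B y] nonneg[of y] by (cases "eps_norm S \<mu> \<epsilon> y = 0") (auto simp: divide_le_eq)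
  then have "bdd_above (range (\<lambda>y. eps_norm S \<mu> \<epsilon> (B *v y) / eps_norm S \<mu> \<epsilon> y))"
    by (intro bdd_aboveI[of _ "C * norm B"]) auto
  then have le: "eps_norm S \<mu> \<epsilon> (B *v x) / eps_norm S \<mu> \<epsilon> x \<le> eps_onorm S \<mu> \<epsilon> B"
    unfolding eps_onorm_def by (intro cSUP_upper) auto
  show ?thesis
  proof (cases "eps_norm S \<mu> \<epsilon> x = 0")
    case True
    then show ?thesis using C(2)[of B x] nonneg[of "B *v x"] by simp
  next
    case False
    then show ?thesis using le nonneg[of x] by (simp add: divide_le_eq)
  qed
qed

lemma eps_onorm_le:
  assumes "0 \<le> \<epsilon>" "0 \<le> b"
    and "\<And>x. eps_norm S \<mu> \<epsilon> (B *v x) \<le> b * eps_norm S \<mu> \<epsilon> x"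
  shows "eps_onorm S \<mu> \<epsilon> B \<le> b"
  unfolding eps_onorm_def
proof (rule cSUP_least)
  fix x
  show "eps_norm S \<mu> \<epsilon> (B *v x) / eps_norm S \<mu> \<epsilon> x \<le> b"
    using assms(2) assms(3)[of x] eps_norm_nonneg[OF assms(1), of x]
    by (cases "eps_norm S \<mu> \<epsilon> x = 0") (auto simp: divide_le_eq)
qed simp

lemma eps_onorm_nonneg:
  assumes "0 < \<epsilon>"
  shows "0 \<le> eps_onorm S \<mu> \<epsilon> B"
proof -
  let ?x = "axis undefined 1 :: real^'n"
  have "eps_embedding \<epsilon> ?x \<noteq> eps_embedding \<epsilon> 0"
    using inj_eps_embedding[OF assms] by (simp add: inj_eq)
  then have "0 < eps_norm S \<mu> \<epsilon> ?x"
    using assms by (simp add: eps_norm_eq_norm linear_0[OF linear_eps_embedding])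
  moreover have "0 \<le> eps_onorm S \<mu> \<epsilon> B * eps_norm S \<mu> \<epsilon> ?x"
    using eps_onorm_bound[OF assms, of B ?x] eps_norm_nonneg[of \<epsilon> "B *v ?x"] assms by linarith
  ultimately show ?thesis by (simp add: zero_le_mult_iff)
qed

section \<open>The coarse correction\<close>

text \<open>
The matrix inverted in \<^const>\<open>S_mat\<close>. For a positive \<open>v\<close> it is \<open>I - C(v)\<close> plus a rank-one term
that removes the stationary vector from the kernel.
\<close>

definition coarse_op :: "real^'n \<Rightarrow> real^'m^'m" where
  "coarse_op v = aggr S ** (mat 1 - P + outer_one \<mu>) ** disaggr S v"

lemma coarse_op_mult:
  "coarse_op v *v z = aggr S *v (disaggr S v *v z - P_hat P \<mu> *v (disaggr S v *v z))"
  by (simp add: coarse_op_def I_minus_P_hat matrix_vector_mult_diff_rdistrib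
      flip: matrix_vector_mul_assoc)

lemma coarse_op_inverse:
  assumes "det (coarse_op v) \<noteq> 0"
  shows "coarse_op v *v (matrix_inv (coarse_op v) *v z) = z"
    and "matrix_inv (coarse_op v) *v (coarse_op v *v z) = z"
  using matrix_inv_cancel[of "coarse_op v"] assms
  by (simp_all add: matrix_vector_mul_assoc invertible_det_nz)

lemma S_mat_mult:
  "S_mat S P \<mu> v *v x
   = disaggr S v *v (matrix_inv (coarse_op v) *v (aggr S *v (x - P_hat P \<mu> *v x)))"
  by (simp add: S_mat_def coarse_op_def I_minus_P_hat matrix_vector_mult_diff_rdistrib
      flip: matrix_vector_mul_assoc)

text \<open>
Together with \<open>S_mat_mult\<close>: \<^const>\<open>S_mat\<close> is a projection onto the range of the disaggregation.
\<close>

lemma S_mat_disaggr: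
  assumes "det (coarse_op v) \<noteq> 0"
  shows "S_mat S P \<mu> v *v (disaggr S v *v z) = disaggr S v *v z"
  by (simp add: S_mat_mult coarse_op_inverse[OF assms] flip: coarse_op_mult)

text \<open>
The Galerkin condition: \<open>S(v) x\<close> solves the equation with operator \<open>I - P'\<close> exactly as far as
aggregation can tell.
\<close>

lemma aggr_residual_S_mat:
  assumes "det (coarse_op v) \<noteq> 0"
  shows "aggr S *v (S_mat S P \<mu> v *v x - P_hat P \<mu> *v (S_mat S P \<mu> v *v x))
         = aggr S *v (x - P_hat P \<mu> *v x)"
  by (simp add: S_mat_mult coarse_op_inverse[OF assms] flip: coarse_op_mult)

lemma J_mat_mult: "J_mat S P \<mu> v *v x = P_hat P \<mu> *v (x - S_mat S P \<mu> v *v x)"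
  by (simp add: J_mat_def matrix_vector_mult_diff_rdistrib flip: matrix_vector_mul_assoc)

text \<open>
A kernel vector disaggregates to a fixed point of \<open>\<Pi> P'\<close>. An orthogonal projection does not increase
the norm and \<open>P'\<close> strictly decreases it, so the fixed point is zero.
\<close>

lemma det_coarse_op_mu: "det (coarse_op \<mu>) \<noteq> 0"
proof -
  have "w = 0" if w: "coarse_op \<mu> *v w = 0" for w
  proof -
    define x where "x = disaggr S \<mu> *v w"
    have w_eq: "aggr S *v x = w" by (simp add: x_def aggr_disaggr mu_pos_vec)
    have "aggr S *v x = aggr S *v (P_hat P \<mu> *v x)"
      using w unfolding coarse_op_mult x_def[symmetric] by (simp add: matrix_vector_mult_diff_distrib)
    then have "x = coarse_proj (P_hat P \<mu> *v x)"
      by (simp add: proj_mult w_eq) (simp add: x_def)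
    then have "mu_inner x x \<le> mu_inner (P_hat P \<mu> *v x) (P_hat P \<mu> *v x)"
      using mu_inner_pythagoras[of "P_hat P \<mu> *v x"] mu_inner_nonneg by simp
    then have "x = 0" using P_hat_contracts[of x] by fastforce
    then show "w = 0" using w_eq by simp
  qed
  then show ?thesis
    using matrix_left_invertible_ker[of "coarse_op \<mu>"]
    by (auto simp: invertible_left_inverse simp flip: invertible_det_nz)
qed

section \<open>The linearisation at the steady state is a contraction\<close>

text \<open>
The factor is \<open>\<rho>\<close> on the fine part; the coarse part enters with the small weight \<open>\<epsilon>\<close>. Only the fine
part \<open>u\<close> of \<open>x\<close> matters, because \<open>I - S(\<mu>)\<close> annihilates the range of \<open>D(\<mu>)\<close>.
\<close>

lemma J_mat_mu_norm_bound:
  obtains \<rho> K where "0 \<le> \<rho>" "\<rho> < 1" "0 \<le> K"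
    "\<And>\<epsilon> x. 0 < \<epsilon> \<Longrightarrow>
      (eps_norm S \<mu> \<epsilon> (J_mat S P \<mu> \<mu> *v x))\<^sup>2 \<le> (\<rho> + \<epsilon> * K) * (eps_norm S \<mu> \<epsilon> x)\<^sup>2"
proof -
  obtain \<rho> where \<rho>: "0 \<le> \<rho>" "\<rho> < 1"
    "\<And>x. mu_inner (P_hat P \<mu> *v x) (P_hat P \<mu> *v x) \<le> \<rho> * mu_inner x x"
    using P_hat_uniform_contraction by blast
  obtain C where C: "0 < C"
    "\<And>B x. eps_norm S \<mu> 1 (B *v x) \<le> C * norm B * eps_norm S \<mu> 1 x"
    using eps_norm_matrix_le[of 1] by auto
  let ?T = "S_mat S P \<mu> \<mu>" and ?J = "J_mat S P \<mu> \<mu>"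
  define k where "k = C * norm (mat 1 - ?T)"
  have norm1: "(eps_norm S \<mu> 1 x)\<^sup>2 = mu_inner x x" for x
    by (subst mu_inner_pythagoras) (simp add: eps_norm_squared)
  have "(eps_norm S \<mu> \<epsilon> (?J *v x))\<^sup>2 \<le> (\<rho> + \<epsilon> * k\<^sup>2) * (eps_norm S \<mu> \<epsilon> x)\<^sup>2" if "0 < \<epsilon>" for \<epsilon> x
  proof -
    define u where "u = x - coarse_proj x"
    define v where "v = u - ?T *v u"
    have T_proj: "?T *v coarse_proj y = coarse_proj y" for y
      by (simp add: proj_mult S_mat_disaggr det_coarse_op_mu)
    have proj_T: "coarse_proj (?T *v y) = ?T *v y" for y
      by (simp add: proj_mult S_mat_mult aggr_disaggr mu_pos_vec)
    have proj_proj: "coarse_proj (coarse_proj y) = coarse_proj y" for y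
      by (simp add: proj_mult aggr_disaggr mu_pos_vec)
    have J_v: "?J *v x = P_hat P \<mu> *v v"
      by (simp add: J_mat_mult v_def u_def T_proj matrix_vector_mult_diff_distrib)
    have "aggr S *v (v - P_hat P \<mu> *v v) = 0"
      using aggr_residual_S_mat[OF det_coarse_op_mu, of u]
      by (simp add: v_def matrix_vector_mult_diff_distrib algebra_simps)
    then have proj_J: "coarse_proj (?J *v x) = coarse_proj v"
      by (simp add: J_v proj_mult matrix_vector_mult_diff_distrib)
    have proj_v: "v - coarse_proj v = u"
      by (simp add: v_def u_def matrix_vector_mult_diff_distrib proj_T proj_proj T_proj)
    have v_le: "mu_inner v v \<le> k\<^sup>2 * mu_inner u u"
    proof -
      have "eps_norm S \<mu> 1 v \<le> k * eps_norm S \<mu> 1 u"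
        using C(2)[of "mat 1 - ?T" u] by (simp add: v_def k_def matrix_vector_mult_diff_rdistrib)
      then have "(eps_norm S \<mu> 1 v)\<^sup>2 \<le> (k * eps_norm S \<mu> 1 u)\<^sup>2"
        by (intro power_mono eps_norm_nonneg) auto
      then show ?thesis by (simp add: norm1 power_mult_distrib)
    qed
    have v_split: "mu_inner v v = mu_inner u u + mu_inner (coarse_proj v) (coarse_proj v)"
      using mu_inner_pythagoras[of v] by (simp add: proj_v)
    have J_split: "mu_inner (P_hat P \<mu> *v v) (P_hat P \<mu> *v v)
        = mu_inner (?J *v x - coarse_proj (?J *v x)) (?J *v x - coarse_proj (?J *v x)) + mu_inner (coarse_proj v) (coarse_proj v)"
      using mu_inner_pythagoras[of "?J *v x"] by (simp add: J_v flip: proj_J)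
    \<comment> \<open>The same coarse energy is removed from \<open>N (P' v)\<close> and, scaled by \<open>\<rho> \<le> 1\<close>, from \<open>\<rho> N v\<close>.\<close>
    have "\<rho> * mu_inner (coarse_proj v) (coarse_proj v) \<le> mu_inner (coarse_proj v) (coarse_proj v)"
      using \<rho> mu_inner_nonneg[of "coarse_proj v"] by (intro mult_left_le_one_le) auto
    then have fine: "mu_inner (?J *v x - coarse_proj (?J *v x)) (?J *v x - coarse_proj (?J *v x)) \<le> \<rho> * mu_inner u u"
      using \<rho>(3)[of v] J_split v_split by (simp add: distrib_left)
    have "\<epsilon> * mu_inner (coarse_proj v) (coarse_proj v) \<le> \<epsilon> * (k\<^sup>2 * mu_inner u u)"
      using that v_le v_split mu_inner_nonneg[of u] by (intro mult_left_mono) auto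
    then have "(eps_norm S \<mu> \<epsilon> (?J *v x))\<^sup>2 \<le> (\<rho> + \<epsilon> * k\<^sup>2) * mu_inner u u"
      unfolding eps_norm_squared[OF less_imp_le[OF that]] proj_J
      using fine by (simp add: proj_J distrib_right mult.assoc)
    also have "\<dots> \<le> (\<rho> + \<epsilon> * k\<^sup>2) * (eps_norm S \<mu> \<epsilon> x)\<^sup>2"
      using that \<rho>(1) mu_inner_nonneg by (intro mult_left_mono) (auto simp: eps_norm_squared u_def)
    finally show ?thesis .
  qed
  then show ?thesis using that[of \<rho> "k\<^sup>2"] \<rho> by simp
qed

lemma eventually_eps_onorm_J_less_1:
  "\<forall>\<^sub>F \<epsilon> in at_right 0. eps_onorm S \<mu> \<epsilon> (J_mat S P \<mu> \<mu>) < 1"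
proof -
  obtain \<rho> K where \<rho>: "0 \<le> \<rho>" "\<rho> < 1" and K: "0 \<le> K"
    and bound: "\<And>\<epsilon> x. 0 < \<epsilon> \<Longrightarrow>
      (eps_norm S \<mu> \<epsilon> (J_mat S P \<mu> \<mu> *v x))\<^sup>2 \<le> (\<rho> + \<epsilon> * K) * (eps_norm S \<mu> \<epsilon> x)\<^sup>2"
    using J_mat_mu_norm_bound by blast
  have "((\<lambda>\<epsilon>. \<rho> + \<epsilon> * K) \<longlongrightarrow> \<rho> + 0 * K) (at_right 0)"
    by (intro tendsto_intros)
  then have "\<forall>\<^sub>F \<epsilon> in at_right 0. \<rho> + \<epsilon> * K < 1"
    using \<rho> by (intro order_tendstoD(2)) auto
  then show ?thesis using eventually_at_right_less[of "0::real"]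
  proof eventually_elim
    case (elim \<epsilon>)
    have "eps_norm S \<mu> \<epsilon> (J_mat S P \<mu> \<mu> *v x) \<le> sqrt (\<rho> + \<epsilon> * K) * eps_norm S \<mu> \<epsilon> x" for x
    proof -
      have "eps_norm S \<mu> \<epsilon> (J_mat S P \<mu> \<mu> *v x) \<le> sqrt ((\<rho> + \<epsilon> * K) * (eps_norm S \<mu> \<epsilon> x)\<^sup>2)"
        using bound[of \<epsilon> x] elim by (intro real_le_rsqrt) auto
      then show ?thesis using elim by (simp add: real_sqrt_mult eps_norm_nonneg)
    qed
    then have "eps_onorm S \<mu> \<epsilon> (J_mat S P \<mu> \<mu>) \<le> sqrt (\<rho> + \<epsilon> * K)"
      using elim \<rho> K by (intro eps_onorm_le) auto
    also have "\<dots> < 1" using elim by simp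
    finally show ?case .
  qed
qed

section \<open>The iteration near the steady state\<close>

lemma aggr_P_hat_mu: "aggr S *v (\<mu> - P_hat P \<mu> *v \<mu>) = aggr S *v \<mu>"
  by (simp add: P_hat_mult steady total_mu)

text \<open>
Vectors of entry sum one fixed by \<open>C(v)\<close> are exactly the solutions of \<open>coarse_op v *v z = A \<mu>\<close>: that
every solution has entry sum one comes from adding up the rows of the equation, where the part
\<open>I - C(v)\<close> contributes nothing.
\<close>

lemma steady_state_coarse_matrix:
  assumes pos: "pos_vec v" and det: "det (coarse_op v) \<noteq> 0"
    and z_pos: "pos_vec (matrix_inv (coarse_op v) *v (aggr S *v \<mu>))"
  shows "steady_state (coarse_matrix S P v) = matrix_inv (coarse_op v) *v (aggr S *v \<mu>)"
proof -
  let ?z = "matrix_inv (coarse_op v) *v (aggr S *v \<mu>)"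
  have coarse: "coarse_op v *v z = z - coarse_matrix S P v *v z + entry_sum z *\<^sub>R (aggr S *v \<mu>)" for z
    by (simp add: coarse_op_mult P_hat_mult total_disaggr[OF pos] coarse_matrix_def
        matrix_vector_mult_diff_distrib aggr_disaggr[OF pos] matrix_vector_mult_scaleR
        flip: matrix_vector_mul_assoc)
  have total_coarse: "entry_sum (coarse_matrix S P v *v z) = entry_sum z" for z
    by (simp add: coarse_matrix_def total_aggr total_P total_disaggr[OF pos]
        flip: matrix_vector_mul_assoc)
  have z: "coarse_op v *v ?z = aggr S *v \<mu>"
    by (rule coarse_op_inverse(1)[OF det])
  have total_z: "entry_sum ?z = 1"
  proof -
    have "entry_sum (coarse_op v *v ?z) = entry_sum ?z * entry_sum (aggr S *v \<mu>)"
      unfolding coarse by (simp add: sum.distrib sum_subtractf total_coarse flip: sum_distrib_left)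
    then show ?thesis unfolding z by (simp add: total_aggr total_mu)
  qed
  have unique: "w = ?z" if "entry_sum w = 1" "coarse_matrix S P v *v w = w" for w
  proof -
    have "coarse_op v *v w = aggr S *v \<mu>" using that by (simp add: coarse)
    then show ?thesis using coarse_op_inverse(2)[OF det, of w] by simp
  qed
  show ?thesis unfolding steady_state_def
  proof (rule the_equality)
    have "coarse_matrix S P v *v ?z = ?z" using coarse[of ?z] total_z unfolding z by simp
    then show "prob_vec ?z \<and> coarse_matrix S P v *v ?z = ?z"
      using z_pos total_z by (simp add: prob_vec_def pos_vec_def less_imp_le)
  qed (use unique in \<open>auto simp: prob_vec_def\<close>)
qed

text \<open>
\<open>S(v)\<close> fixes \<open>v\<close>, which lies in the range of \<open>D(v)\<close>, and sends \<open>\<mu>\<close> to the intermediate iterate,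
because \<open>(I - P') \<mu> = \<mu>\<close>. Hence \<open>(I - S(v))(v - \<mu>)\<close> is the error of the intermediate iterate, and on
this vector of entry sum \<open>0\<close> the matrices \<open>P'\<close> and \<open>P\<close> agree.
\<close>

lemma iad_step_error:
  assumes pos: "pos_vec v" and tot: "entry_sum v = 1" and det: "det (coarse_op v) \<noteq> 0"
    and z_pos: "pos_vec (matrix_inv (coarse_op v) *v (aggr S *v \<mu>))"
  shows "P *v iad_half S P v - \<mu> = J_mat S P \<mu> v *v (v - \<mu>)"
    and "entry_sum (P *v iad_half S P v) = 1"
proof -
  let ?h = "iad_half S P v"
  have half: "S_mat S P \<mu> v *v \<mu> = ?h"
    by (simp add: S_mat_mult aggr_P_hat_mu iad_half_def steady_state_coarse_matrix[OF pos det z_pos])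
  have "S_mat S P \<mu> v *v v = v"
    using S_mat_disaggr[OF det, of "aggr S *v v"] by (simp add: disaggr_aggr_self[OF pos])
  then have "J_mat S P \<mu> v *v (v - \<mu>) = P_hat P \<mu> *v (?h - \<mu>)"
    by (simp add: J_mat_mult matrix_vector_mult_diff_distrib half)
  moreover have total_h: "entry_sum ?h = 1"
  proof -
    have "entry_sum (aggr S *v (?h - P_hat P \<mu> *v ?h)) = entry_sum (aggr S *v \<mu>)"
      using aggr_residual_S_mat[OF det, of \<mu>] by (simp add: half aggr_P_hat_mu)
    then show ?thesis
      unfolding total_aggr
      by (simp add: P_hat_mult sum_subtractf total_P total_mu flip: sum_distrib_left)
  qed
  ultimately show "P *v ?h - \<mu> = J_mat S P \<mu> v *v (v - \<mu>)"
    by (simp add: P_hat_mult matrix_vector_mult_diff_distrib steady sum_subtractf total_mu)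
  show "entry_sum (P *v ?h) = 1" using total_h by (simp add: total_P)
qed

lemma tendsto_coarse_op: "(coarse_op \<longlongrightarrow> coarse_op \<mu>) (nhds \<mu>)"
  unfolding coarse_op_def[abs_def]
  by (intro tendsto_matrix_mult tendsto_const tendsto_disaggr mu_pos_vec)

lemma tendsto_J_mat: "(J_mat S P \<mu> \<longlongrightarrow> J_mat S P \<mu> \<mu>) (nhds \<mu>)"
  unfolding J_mat_def[abs_def] S_mat_def[abs_def] coarse_op_def[symmetric]
  by (intro tendsto_matrix_mult tendsto_const tendsto_disaggr mu_pos_vec tendsto_diff
      tendsto_matrix_inv tendsto_coarse_op det_coarse_op_mu)

text \<open>
At \<open>\<mu>\<close> the coarse solution is the aggregated steady state, in particular positive.
\<close>

lemma coarse_op_mu_inverse: "matrix_inv (coarse_op \<mu>) *v (aggr S *v \<mu>) = aggr S *v \<mu>"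
proof -
  have "coarse_op \<mu> *v (aggr S *v \<mu>) = aggr S *v \<mu>"
    by (simp add: coarse_op_mult disaggr_aggr_self[OF mu_pos_vec] aggr_P_hat_mu)
  then show ?thesis using coarse_op_inverse(2)[OF det_coarse_op_mu, of "aggr S *v \<mu>"] by simp
qed

lemma eventually_near_steady_state:
  assumes "0 < \<delta>"
  shows "\<forall>\<^sub>F v in nhds \<mu>. pos_vec v \<and> det (coarse_op v) \<noteq> 0
    \<and> pos_vec (matrix_inv (coarse_op v) *v (aggr S *v \<mu>))
    \<and> norm (J_mat S P \<mu> v - J_mat S P \<mu> \<mu>) < \<delta>"
proof (intro eventually_conj)
  show "\<forall>\<^sub>F v in nhds \<mu>. pos_vec v"
    by (rule eventually_pos_vec[OF filterlim_ident mu_pos_vec])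
  show "\<forall>\<^sub>F v in nhds \<mu>. det (coarse_op v) \<noteq> 0"
    by (rule tendsto_imp_eventually_ne[OF tendsto_det[OF tendsto_coarse_op] det_coarse_op_mu])
  have "((\<lambda>v. matrix_inv (coarse_op v) *v (aggr S *v \<mu>))
      \<longlongrightarrow> matrix_inv (coarse_op \<mu>) *v (aggr S *v \<mu>)) (nhds \<mu>)"
    by (intro tendsto_matrix_vector_mult tendsto_const tendsto_matrix_inv tendsto_coarse_op
        det_coarse_op_mu)
  then show "\<forall>\<^sub>F v in nhds \<mu>. pos_vec (matrix_inv (coarse_op v) *v (aggr S *v \<mu>))"
    unfolding coarse_op_mu_inverse by (rule eventually_pos_vec[OF _ aggr_pos[OF mu_pos_vec]])
  show "\<forall>\<^sub>F v in nhds \<mu>. norm (J_mat S P \<mu> v - J_mat S P \<mu> \<mu>) < \<delta>"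
    using tendstoD[OF tendsto_J_mat assms] by (simp add: dist_norm)
qed

text \<open>
The perturbation \<open>J(v) - J(\<mu>)\<close> uses up the allowance \<open>\<eta>\<close>, and the total factor is at most one, so the
ball of radius \<open>r\<close> is invariant. It is small enough to lie in the open set of positive vectors on which
the error formula holds.
\<close>

lemma iad_local_convergence:
  assumes "0 < \<epsilon>" and "0 < \<eta>"
    and \<eta>: "\<eta> \<le> 1 - eps_onorm S \<mu> \<epsilon> (J_mat S P \<mu> \<mu>)"
  shows "\<exists>r>0. \<forall>\<mu>0. prob_vec \<mu>0 \<and> eps_norm S \<mu> \<epsilon> (\<mu>0 - \<mu>) \<le> r \<longrightarrow>
    (\<forall>k. eps_norm S \<mu> \<epsilon> (iad S P \<mu>0 k - \<mu>)
         \<le> (eps_onorm S \<mu> \<epsilon> (J_mat S P \<mu> \<mu>) + \<eta>) ^ k * eps_norm S \<mu> \<epsilon> (\<mu>0 - \<mu>))"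
proof -
  let ?J = "J_mat S P \<mu>" and ?N = "eps_norm S \<mu> \<epsilon>"
  define q where "q = eps_onorm S \<mu> \<epsilon> (?J \<mu>) + \<eta>"
  have q: "0 \<le> q" "q \<le> 1"
    using eps_onorm_nonneg[OF assms(1), of "?J \<mu>"] assms by (auto simp: q_def)
  have N_nonneg: "0 \<le> ?N x" for x using assms(1) by (simp add: eps_norm_nonneg)
  obtain C where C: "0 < C" "\<And>B x. ?N (B *v x) \<le> C * norm B * ?N x"
    using eps_norm_matrix_le[OF assms(1)] by blast
  obtain d where d: "0 < d"
    and near: "\<And>v. dist v \<mu> < d \<Longrightarrow> pos_vec v \<and> det (coarse_op v) \<noteq> 0
      \<and> pos_vec (matrix_inv (coarse_op v) *v (aggr S *v \<mu>)) \<and> norm (?J v - ?J \<mu>) < \<eta> / C"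
    using eventually_near_steady_state[of "\<eta> / C"] assms(2) C(1)
    unfolding eventually_nhds_metric by auto
  obtain b where b: "0 < b" "\<And>x. b * norm x \<le> ?N x"
    using linear_inj_bounded_below_pos[OF linear_eps_embedding inj_eps_embedding[OF assms(1)]]
      eps_norm_eq_norm assms(1) by (metis less_imp_le)
  \<comment> \<open>\<open>b\<close> converts the \<open>\<epsilon>\<close>-ball into a Euclidean one; the half makes the inequality with \<open>d\<close> strict.\<close>
  define r where "r = b * d / 2"
  have r: "0 < r" using b d by (simp add: r_def)
  have step: "entry_sum (P *v iad_half S P v) = 1 \<and> ?N (P *v iad_half S P v - \<mu>) \<le> q * ?N (v - \<mu>)"
    if v: "entry_sum v = 1" "?N (v - \<mu>) \<le> r" for v
  proof -
    have "b * norm (v - \<mu>) \<le> b * (d / 2)" using b(2)[of "v - \<mu>"] v by (simp add: r_def)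
    then have "dist v \<mu> < d" using b(1) d by (simp add: dist_norm)
    note near_v = near[OF this]
    have "P *v iad_half S P v - \<mu> = ?J \<mu> *v (v - \<mu>) + (?J v - ?J \<mu>) *v (v - \<mu>)"
      using iad_step_error(1)[of v] near_v v by (simp add: matrix_vector_mult_diff_rdistrib)
    then have "?N (P *v iad_half S P v - \<mu>) \<le> ?N (?J \<mu> *v (v - \<mu>)) + ?N ((?J v - ?J \<mu>) *v (v - \<mu>))"
      using eps_norm_triangle[of \<epsilon>] assms(1) by simp
    also have "?N ((?J v - ?J \<mu>) *v (v - \<mu>)) \<le> C * norm (?J v - ?J \<mu>) * ?N (v - \<mu>)"
      by (rule C(2))
    also have "\<dots> \<le> \<eta> * ?N (v - \<mu>)"
      using near_v C(1) N_nonneg by (intro mult_right_mono) (auto simp: field_simps)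
    also have "?N (?J \<mu> *v (v - \<mu>)) \<le> eps_onorm S \<mu> \<epsilon> (?J \<mu>) * ?N (v - \<mu>)"
      by (rule eps_onorm_bound[OF assms(1)])
    finally show ?thesis
      using iad_step_error(2)[of v] near_v v by (simp add: q_def distrib_right)
  qed
  have "?N (iad S P \<mu>0 k - \<mu>) \<le> q ^ k * ?N (\<mu>0 - \<mu>)"
    if "prob_vec \<mu>0" "?N (\<mu>0 - \<mu>) \<le> r" for \<mu>0 k
  proof -
    have "entry_sum (iad S P \<mu>0 k) = 1 \<and> ?N (iad S P \<mu>0 k - \<mu>) \<le> q ^ k * ?N (\<mu>0 - \<mu>)"
    proof (induction k)
      case 0
      then show ?case using that by (simp add: prob_vec_def)
    next
      case (Suc k)
      have "q ^ k * ?N (\<mu>0 - \<mu>) \<le> ?N (\<mu>0 - \<mu>)"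
        using q N_nonneg by (intro mult_left_le_one_le) (auto simp: power_le_one)
      then have "?N (iad S P \<mu>0 k - \<mu>) \<le> r" using Suc that by linarith
      then have "entry_sum (iad S P \<mu>0 (Suc k)) = 1 \<and>
          ?N (iad S P \<mu>0 (Suc k) - \<mu>) \<le> q * ?N (iad S P \<mu>0 k - \<mu>)"
        using step[of "iad S P \<mu>0 k"] Suc by simp
      moreover have "q * ?N (iad S P \<mu>0 k - \<mu>) \<le> q * (q ^ k * ?N (\<mu>0 - \<mu>))"
        using Suc q by (intro mult_left_mono) auto
      ultimately show ?case by (simp add: mult.assoc)
    qed
    then show ?thesis ..
  qed
  then show ?thesis using r unfolding q_def by blast
qed

end

theorem theorem2:
  fixes P :: "real^'n::finite^'n"
    and \<mu> :: "real^'n"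
    and S :: "'m::finite \<Rightarrow> 'n set"
  assumes stoch: "column_stochastic P"
    and irr: "irreducible_mat P"
    and irr_PtP: "irreducible_mat (transpose P ** P)"
    and prob: "prob_vec \<mu>"
    and steady: "P *v \<mu> = \<mu>"
    and part: "coarse_partition S"
  shows "(\<forall>\<^sub>F \<epsilon> in at_right 0. eps_onorm S \<mu> \<epsilon> (J_mat S P \<mu> \<mu>) < 1) \<and>
    (\<forall>\<epsilon>>0. eps_onorm S \<mu> \<epsilon> (J_mat S P \<mu> \<mu>) < 1 \<longrightarrow>
      (\<forall>\<eta>. 0 < \<eta> \<and> \<eta> \<le> 1 - eps_onorm S \<mu> \<epsilon> (J_mat S P \<mu> \<mu>) \<longrightarrow>
        (\<exists>r>0. \<forall>\<mu>0. prob_vec \<mu>0 \<and> pos_vec \<mu>0 \<and> eps_norm S \<mu> \<epsilon> (\<mu>0 - \<mu>) \<le> r \<longrightarrow>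
          (\<forall>k. eps_norm S \<mu> \<epsilon> (iad S P \<mu>0 k - \<mu>)
               \<le> (eps_onorm S \<mu> \<epsilon> (J_mat S P \<mu> \<mu>) + \<eta>) ^ k * eps_norm S \<mu> \<epsilon> (\<mu>0 - \<mu>)))))"
proof -
  interpret partitioned_chain S P \<mu>
    by unfold_locales (fact part stoch irr irr_PtP prob steady)+
  show ?thesis using eventually_eps_onorm_J_less_1 iad_local_convergence by meson
qed

end
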